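(* Let $S$ be a finite group, $p$ a prime, and $A$ a normal subgroup of $S$ of index $p$. Suppose that $K \leq S$ is a subgroup not contained in $A$, and let $H = K \cap A$. Then the coset spaces $S/K$ and $A/H$ are equivalent (isomorphic) as $A$-sets. In particular, \[ \beta_{S/K}(U) = \beta_{A/H}(U) \] for all subgroups $U \leq A$.
   Context: For a finite group $G$, a finite (right) $G$-set $X$ and a subgroup $L \leq G$, the mark is $\beta_{X}(L) = \#\{x \in X : x.l = x \text{ for all } l \in L\}$. For $K \leq G$, $G/K$ is the set of right cosets $Kg$, on which $G$ acts by right multiplication; $S/K$ is an $A$-set by restriction. *)

theory Defs
  imports "HOL-Algebra.Group_Action" "HOL-Computational_Algebra.Primes"
begin

text \<open>
  Finite right \<open>G\<close>-sets. \<^locale>\<open>group_action\<close> is about left actions, whereas here a group acts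
  on cosets \<open>K #> g\<close> by right multiplication.
\<close>

locale finite_right_gset = group G for G (structure) +
  fixes X :: "'x set" and act :: "'x \<Rightarrow> 'a \<Rightarrow> 'x"
  assumes finite_group: "finite (carrier G)"
    and finite_set: "finite X"
    and act_closed: "\<lbrakk>x \<in> X; g \<in> carrier G\<rbrakk> \<Longrightarrow> act x g \<in> X"
    and act_one: "x \<in> X \<Longrightarrow> act x \<one> = x"
    and act_mult: "\<lbrakk>x \<in> X; g \<in> carrier G; h \<in> carrier G\<rbrakk> \<Longrightarrow> act x (g \<otimes> h) = act (act x g) h"

definition gset_isomorphic ::
  "('g, 'm) monoid_scheme \<Rightarrow> 'x set \<Rightarrow> ('x \<Rightarrow> 'g \<Rightarrow> 'x) \<Rightarrow> 'y set \<Rightarrow> ('y \<Rightarrow> 'g \<Rightarrow> 'y) \<Rightarrow> bool"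
  where "gset_isomorphic G X act Y act' \<longleftrightarrow>
    finite_right_gset G X act \<and> finite_right_gset G Y act' \<and>
    (\<exists>f. bij_betw f X Y \<and> (\<forall>x\<in>X. \<forall>g\<in>carrier G. f (act x g) = act' (f x) g))"

definition mark :: "'x set \<Rightarrow> ('x \<Rightarrow> 'g \<Rightarrow> 'x) \<Rightarrow> 'g set \<Rightarrow> nat"
  where "mark X act L = card {x \<in> X. \<forall>l\<in>L. act x l = x}"

end

theory Submission
  imports Defs "HOL-Algebra.Zassenhaus"
begin

text \<open>
  Since \<open>A\<close> has prime index and \<open>K\<close> is not contained in \<open>A\<close>, the subgroup \<open>KA\<close> is all of \<open>S\<close>.
  Hence every coset of \<open>K\<close> has the form \<open>Ka\<close> with \<open>a \<in> A\<close>, and \<open>Ka \<inter> A = (K \<inter> A)a\<close>. The required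
  isomorphism is therefore \<open>C \<mapsto> C \<inter> A\<close>.
\<close>

text \<open>Normality of \<open>A\<close> makes \<open>K <#> A\<close> a subgroup, and it is
  strictly larger than \<open>A\<close> because it contains \<open>K\<close>. By multiplicativity of
  the index, the index of \<open>K <#> A\<close> divides the prime index of \<open>A\<close> and
  differs from it, so it is 1.\<close>

lemma (in group) normal_prime_index_mult_eq_carrier:
  assumes "finite (carrier G)" "A \<lhd> G" "prime (card (rcosets A))" "subgroup K G" "\<not> K \<subseteq> A"
  shows "K <#> A = carrier G"
proof -
  have A: "subgroup A G" using assms(2) by (rule normal_imp_subgroup)
  have comm: "K <#> A = A <#> K"
    using commut_normal[OF assms(4,2)] .
  have KA: "subgroup (K <#> A) G"
    using mult_norm_subgroup[OF assms(2,4)] comm by simp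
  have sub: "A \<subseteq> K <#> A"
    using subgroup.one_closed[OF assms(4)] subgroup.mem_carrier[OF A]
    by (force simp: set_mult_def)
  have "K \<subseteq> K <#> A"
    using subgroup.one_closed[OF A] subgroup.mem_carrier[OF assms(4)]
    by (force simp: set_mult_def)
  then have psub: "card A < card (K <#> A)"
    using sub assms(5) finite_subset[OF subgroup.subset[OF KA] assms(1)]
    by (intro psubset_card_mono) auto
  have "group (G\<lparr>carrier := K <#> A\<rparr>)"
    using KA by (rule subgroup_imp_group)
  \<comment> \<open>Lagrange is applied twice: \<open>m\<close> is the index of \<open>A\<close>
    inside the group on \<open>K <#> A\<close>, and \<open>n\<close> below is the index of
    \<open>K <#> A\<close> in \<open>G\<close>.\<close>
  then obtain m where m: "m * card A = card (K <#> A)"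
    using group.lagrange[OF _ subgroup_incl[OF A KA sub]] by (auto simp: order_def)
  obtain n where n: "n * card (K <#> A) = order G"
    using lagrange[OF KA] by blast
  have pos: "card A > 0"
    using subgroup.finite_imp_card_positive[OF A assms(1)] .
  have "(n * m) * card A = card (rcosets A) * card A"
    using lagrange[OF A] m n by (simp add: mult.assoc)
  then have nm: "n * m = card (rcosets A)" using pos by simp
  \<comment> \<open>\<open>m = 1\<close> would give \<open>A\<close> and \<open>K <#> A\<close> the
    same cardinality. As \<open>n * m\<close> is prime, the other factor \<open>n\<close> must then
    be 1.\<close>
  have "m \<noteq> 1" using m psub by auto
  then have "n = 1"
    using assms(3) nm by (metis prime_product)
  then have "card (K <#> A) = card (carrier G)"
    using n by (simp add: order_def)
  then show ?thesis
    using subgroup.subset[OF KA] assms(1) by (intro card_subset_eq)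
qed

lemma (in group) finite_right_gset_rcosets:
  assumes "finite (carrier G)" "subgroup K G"
  shows "finite_right_gset G (rcosets K) (r_coset G)"
proof
  show "finite (carrier G)" by fact
  show "finite (rcosets K)"
    using assms(1) by (simp add: RCOSETS_def)
next
  fix C g assume "C \<in> rcosets K" "g \<in> carrier G"
  then show "C #> g \<in> rcosets K"
    using subgroup.subset[OF assms(2)] by (auto simp: RCOSETS_def coset_mult_assoc)
next
  fix C assume "C \<in> rcosets K"
  then show "C #> \<one> = C"
    using assms(2) rcosets_part_G by (intro coset_mult_one) blast
next
  fix C g h assume "C \<in> rcosets K" "g \<in> carrier G" "h \<in> carrier G"
  then show "C #> (g \<otimes> h) = C #> g #> h"
    using assms(2) rcosets_part_G by (subst coset_mult_assoc) blast+
qed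

lemma (in finite_right_gset) finite_right_gset_restrict:
  assumes "subgroup A G"
  shows "finite_right_gset (G\<lparr>carrier := A\<rparr>) X act"
proof -
  interpret A: group "G\<lparr>carrier := A\<rparr>"
    using assms by (rule subgroup_imp_group)
  show ?thesis
    using finite_subset[OF subgroup.subset[OF assms] finite_group] finite_set
      act_closed act_one act_mult subgroup.mem_carrier[OF assms]
    by unfold_locales auto
qed

text \<open>By equivariance and injectivity, \<open>x\<close> is fixed by \<open>l\<close> exactly
  when \<open>f x\<close> is. So the isomorphism restricts to a bijection between the points fixed
  by \<open>U\<close>.\<close>

lemma mark_eq_if_gset_isomorphic:
  assumes "gset_isomorphic G X act Y act'" "U \<subseteq> carrier G"
  shows "mark X act U = mark Y act' U"
proof -
  obtain f where f: "bij_betw f X Y"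
    and equiv: "\<And>x g. x \<in> X \<Longrightarrow> g \<in> carrier G \<Longrightarrow> f (act x g) = act' (f x) g"
    and X: "finite_right_gset G X act"
    using assms(1) unfolding gset_isomorphic_def by blast
  have fixed: "act' (f x) l = f x \<longleftrightarrow> act x l = x" if "x \<in> X" "l \<in> U" for x l
  proof -
    \<comment> \<open>Injectivity of \<open>f\<close> is only known on \<open>X\<close>, so both
      \<open>act x l\<close> and \<open>x\<close> have to lie there before \<open>f\<close> can be
      cancelled.\<close>
    have "act x l \<in> X"
      using finite_right_gset.act_closed[OF X] that assms(2) by blast
    then show ?thesis
      using that assms(2) equiv[of x l] inj_on_eq_iff[OF bij_betw_imp_inj_on[OF f]]
      by (metis subsetD)
  qed
  have "f ` {x \<in> X. \<forall>l\<in>U. act x l = x} = {y \<in> Y. \<forall>l\<in>U. act' y l = y}"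
    using fixed bij_betw_imp_surj_on[OF f] by auto
  then have "bij_betw f {x \<in> X. \<forall>l\<in>U. act x l = x} {y \<in> Y. \<forall>l\<in>U. act' y l = y}"
    using f by (intro bij_betw_subset[OF f]) auto
  then show ?thesis
    unfolding mark_def by (rule bij_betw_same_card)
qed

text \<open>Cancelling \<open>a\<close> shows that \<open>c \<otimes> a\<close> lies in
  \<open>A\<close> only if \<open>c\<close> does. With \<open>C = K\<close> this identifies the
  image of a coset of \<open>K\<close> under intersection with \<open>A\<close>; with
  \<open>C\<close> a coset it is the equivariance of that map.\<close>

lemma (in group) r_coset_Int_subgroup:
  assumes "subgroup A G" "C \<subseteq> carrier G" "a \<in> A"
  shows "(C #> a) \<inter> A = (C \<inter> A) #> a"
proof -
  have "c \<in> A" if "c \<in> C" "c \<otimes> a \<in> A" for c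
  proof -
    have "c \<otimes> a \<otimes> inv a \<in> A"
      using assms(1,3) that(2) by (simp add: subgroup.m_closed subgroup.m_inv_closed)
    then show ?thesis
      using assms that(1) subgroup.mem_carrier[OF assms(1)] by (auto simp: m_assoc subset_iff)
  qed
  then show ?thesis
    using assms(1,3) by (auto simp: r_coset_def subgroup.m_closed)
qed

text \<open>The factorisation of the carrier gives every coset of \<open>K\<close> a representative
  in \<open>A\<close>. Hence each coset meets \<open>A\<close>, and since distinct cosets are
  disjoint, the intersection determines the coset.\<close>

lemma (in group) bij_betw_rcosets_Int:
  assumes "subgroup A G" "subgroup K G" "K <#> A = carrier G"
  shows "bij_betw (\<lambda>C. C \<inter> A) (rcosets K) (rcosets\<^bsub>G\<lparr>carrier := A\<rparr>\<^esub> (K \<inter> A))"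
proof -
  have KG: "K \<subseteq> carrier G" by (rule subgroup.subset[OF assms(2)])
  have AG: "A \<subseteq> carrier G" by (rule subgroup.subset[OF assms(1)])
  have rep: "\<exists>a\<in>A. C = K #> a" if C: "C \<in> rcosets K" for C
  proof -
    obtain g where g: "g \<in> carrier G" "C = K #> g"
      using C by (auto simp: RCOSETS_def)
    then have "g \<in> K <#> A"
      using assms(3) by simp
    then obtain k a where ka: "k \<in> K" "a \<in> A" "g = k \<otimes> a"
      by (auto simp: set_mult_def)
    \<comment> \<open>The factor \<open>k\<close> is absorbed by \<open>K\<close>, leaving
      \<open>a\<close> as a representative of the same coset.\<close>
    have "K #> (k \<otimes> a) = K #> k #> a"
      using ka KG AG by (subst coset_mult_assoc) auto
    moreover have "K #> k = K"
      using ka KG by (intro coset_join2[OF _ assms(2)]) auto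
    ultimately have "C = K #> a"
      using g ka by simp
    then show ?thesis using ka(2) by blast
  qed
  have Int: "(K #> a) \<inter> A = (K \<inter> A) #> a" if "a \<in> A" for a
    using r_coset_Int_subgroup[OF assms(1) KG that] .
  have "inj_on (\<lambda>C. C \<inter> A) (rcosets K)"
  proof (rule inj_onI)
    fix C D assume CD: "C \<in> rcosets K" "D \<in> rcosets K" "C \<inter> A = D \<inter> A"
    then obtain a where "a \<in> A" "C = K #> a" using rep by blast
    \<comment> \<open>The point \<open>a\<close> lies in \<open>C \<inter> A = D \<inter> A\<close>,
      hence in both cosets, which therefore coincide.\<close>
    then have "a \<in> C" using rcos_self[OF _ assms(2)] AG by auto
    then show "C = D"
      using CD \<open>a \<in> A\<close> rcos_disjoint[OF assms(2)] unfolding pairwise_def disjnt_def by blast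
  qed
  moreover have "(\<lambda>C. C \<inter> A) ` (rcosets K) = rcosets\<^bsub>G\<lparr>carrier := A\<rparr>\<^esub> (K \<inter> A)"
  proof (intro equalityI subsetI)
    fix D assume "D \<in> (\<lambda>C. C \<inter> A) ` (rcosets K)"
    then obtain a where "a \<in> A" "D = (K #> a) \<inter> A" using rep by blast
    \<comment> \<open>Restricting the carrier keeps the multiplication, so after unfolding, cosets
      by elements of \<open>A\<close> are the same sets in both groups.\<close>
    then show "D \<in> rcosets\<^bsub>G\<lparr>carrier := A\<rparr>\<^esub> (K \<inter> A)"
      using Int by (auto simp: RCOSETS_def r_coset_def)
  next
    fix D assume "D \<in> rcosets\<^bsub>G\<lparr>carrier := A\<rparr>\<^esub> (K \<inter> A)"
    then obtain a where "a \<in> A" "D = (K \<inter> A) #> a"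
      by (auto simp: RCOSETS_def r_coset_def)
    then show "D \<in> (\<lambda>C. C \<inter> A) ` (rcosets K)"
      using Int AG KG by (intro image_eqI[of _ _ "K #> a"] rcosetsI) auto
  qed
  ultimately show ?thesis by (simp add: bij_betw_def)
qed

theorem proposition4p2:
  fixes S :: "('a, 'b) monoid_scheme" and p :: nat and A K H :: "'a set"
  assumes "group S"
    and "finite (carrier S)"
    and "prime p"
    and "A \<lhd> S"
    and "card (rcosets\<^bsub>S\<^esub> A) = p"
    and "subgroup K S"
    and "\<not> K \<subseteq> A"
    and "H = K \<inter> A"
  shows "gset_isomorphic (S\<lparr>carrier := A\<rparr>)
           (rcosets\<^bsub>S\<^esub> K) (r_coset S)
           (rcosets\<^bsub>S\<lparr>carrier := A\<rparr>\<^esub> H) (r_coset (S\<lparr>carrier := A\<rparr>)) \<and>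
         (\<forall>U. subgroup U (S\<lparr>carrier := A\<rparr>) \<longrightarrow>
           mark (rcosets\<^bsub>S\<^esub> K) (r_coset S) U =
           mark (rcosets\<^bsub>S\<lparr>carrier := A\<rparr>\<^esub> H) (r_coset (S\<lparr>carrier := A\<rparr>)) U)"
proof -
  interpret S: group S by fact
  have A: "subgroup A S" using assms(4) by (rule normal_imp_subgroup)
  interpret A: group "S\<lparr>carrier := A\<rparr>"
    using A by (rule S.subgroup_imp_group)
  have "K <#>\<^bsub>S\<^esub> A = carrier S"
    using assms by (intro S.normal_prime_index_mult_eq_carrier) auto
  then have bij: "bij_betw (\<lambda>C. C \<inter> A) (rcosets\<^bsub>S\<^esub> K) (rcosets\<^bsub>S\<lparr>carrier := A\<rparr>\<^esub> H)"
    using S.bij_betw_rcosets_Int[OF A assms(6)] assms(8) by simp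
  have H: "subgroup H (S\<lparr>carrier := A\<rparr>)"
    unfolding assms(8) using A assms(6) by (intro S.subgroup_incl S.subgroups_Inter_pair) auto
  \<comment> \<open>The cosets of \<open>K\<close> form an \<open>S\<close>-set whose action is
    restricted to \<open>A\<close>; the cosets of \<open>H\<close> are treated below directly over
    the group on \<open>A\<close>.\<close>
  have "finite_right_gset (S\<lparr>carrier := A\<rparr>) (rcosets\<^bsub>S\<^esub> K) (r_coset S)"
    using S.finite_right_gset_rcosets[OF assms(2,6)] A
    by (rule finite_right_gset.finite_right_gset_restrict)
  moreover have "finite_right_gset (S\<lparr>carrier := A\<rparr>)
      (rcosets\<^bsub>S\<lparr>carrier := A\<rparr>\<^esub> H) (r_coset (S\<lparr>carrier := A\<rparr>))"
    using finite_subset[OF subgroup.subset[OF A] assms(2)] H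
    by (intro A.finite_right_gset_rcosets) auto
  \<comment> \<open>This is equivariance of \<open>C \<mapsto> C \<inter> A\<close> under
    \<open>A\<close>.\<close>
  moreover have "(C #>\<^bsub>S\<^esub> g) \<inter> A = (C \<inter> A) #>\<^bsub>S\<lparr>carrier := A\<rparr>\<^esub> g"
    if "C \<in> rcosets\<^bsub>S\<^esub> K" "g \<in> A" for C g
    using S.r_coset_Int_subgroup[OF A subgroup.rcosets_carrier[OF assms(6,1) that(1)] that(2)]
    by (simp add: r_coset_def)
  ultimately have iso: "gset_isomorphic (S\<lparr>carrier := A\<rparr>)
      (rcosets\<^bsub>S\<^esub> K) (r_coset S)
      (rcosets\<^bsub>S\<lparr>carrier := A\<rparr>\<^esub> H) (r_coset (S\<lparr>carrier := A\<rparr>))"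
    using bij unfolding gset_isomorphic_def by auto
  then show ?thesis
    using mark_eq_if_gset_isomorphic[OF iso] subgroup.subset by blast
qed

end
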